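(* Let $(X,\|\cdot\|)$ be a Banach space, let $B\subset X$ be a symmetric compact convex set, let $p>0$, and for $t\ge 0$ define $$B_t := \{ y\in B : \exists\,z\in X^*\mbox{ such that } \langle z,y\rangle = \|y\|_B,~\|z\|_B^*\le 1,~\|z\|^*\le t\}.$$ Then for any $a>0$ $$\gamma_p(B) \lesssim \frac{1}{a} + \sum_{n\ge 0} 2^{n/p} e_n(B_{a2^{n/p}}),$$ where the universal constant depends on $p$ only.
   Context: $X$ is a real Banach space with dual $X^*$. The gauge of $B$ is $\|x\|_B:=\inf\{s\ge 0: x\in sB\}$ for $x\in X$ (equal to $+\infty$ if no such $s$ exists). For $z\in X^*$, $\|z\|_B^*:=\sup_{x\in B}\langle z,x\rangle$ and $\|z\|^*:=\sup_{\|x\|\le 1}\langle z,x\rangle$. The metric is $d(x,y):=\|x-y\|$. For $A\subseteq X$ and $n\ge 0$, the entropy number is $e_n(A):=\inf_{|\tilde A|<2^{2^n}}\sup_{x\in A}d(x,\tilde A)$, and for $p>0$, $\gamma_p(A):=\inf_{|\tilde A_n|<2^{2^n}}\sup_{x\in A}\sum_{n\ge 0}2^{n/p}d(x,\tilde A_n)$, where the infima are over (sequences of) nonempty finite subsets of $X$ (not necessarily of $A$) of the indicated cardinality, and $d(x,S):=\inf_{s\in S}d(x,s)$. The notation $a\lesssim b$ means $a\le Cb$ for a constant $C$, here depending only on $p$. *)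

theory Defs
  imports "HOL-Analysis.Analysis"
begin

text \<open>
  The topological dual \<open>X\<^sup>*\<close> is the type \<open>'a \<Rightarrow>\<^sub>L real\<close>. The gauge and the support function
  are extended real valued: an empty infimum is \<open>\<infinity>\<close>.
\<close>

definition set_gauge :: "'a::real_vector set \<Rightarrow> 'a \<Rightarrow> ereal" where
  "set_gauge B x = (INF s\<in>{s::real. 0 \<le> s \<and> x \<in> (*\<^sub>R) s ` B}. ereal s)"

definition dual_set_norm :: "'a::real_normed_vector set \<Rightarrow> ('a \<Rightarrow>\<^sub>L real) \<Rightarrow> ereal" where
  "dual_set_norm B z = (SUP x\<in>B. ereal (blinfun_apply z x))"

text \<open>
  For the unit ball the support function is the operator norm of the dual, so that the condition
  \<open>\<parallel>z\<parallel>\<^sup>* \<le> t\<close> below is expressed by \<open>norm z \<le> t\<close>.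
\<close>

lemma dual_set_norm_cball:
  fixes z :: "'a::real_normed_vector \<Rightarrow>\<^sub>L real"
  shows "dual_set_norm (cball 0 1) z = ereal (norm z)"
proof (rule antisym)
  have "blinfun_apply z x \<le> norm z" if "norm x \<le> 1" for x
  proof -
    have "blinfun_apply z x \<le> norm (blinfun_apply z x)" by simp
    also have "\<dots> \<le> norm z * norm x" by (rule norm_blinfun)
    also have "\<dots> \<le> norm z * 1" using that by (intro mult_left_mono) auto
    finally show ?thesis by simp
  qed
  then show "dual_set_norm (cball 0 1) z \<le> ereal (norm z)"
    by (auto simp: dual_set_norm_def intro!: SUP_least)
next
  show "ereal (norm z) \<le> dual_set_norm (cball 0 1) z"
  proof (rule ereal_le_real)
    fix c :: real assume "dual_set_norm (cball 0 1) z \<le> ereal c"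
    then have c: "blinfun_apply z x \<le> c" if "norm x \<le> 1" for x
      using that unfolding dual_set_norm_def SUP_le_iff by auto
    have "0 \<le> c" using c[of 0] by (simp add: blinfun.zero_right)
    moreover have "norm (blinfun_apply z x) \<le> c * norm x" for x
    proof (cases "x = 0")
      case False
      have "blinfun_apply z x \<le> c * norm x" "- blinfun_apply z x \<le> c * norm x"
        using c[of "(1 / norm x) *\<^sub>R x"] c[of "- (1 / norm x) *\<^sub>R x"] False
        by (simp_all add: blinfun.scaleR_right blinfun.minus_right field_simps)
      then show ?thesis by (simp add: abs_le_iff)
    qed (simp add: blinfun.zero_right)
    ultimately show "ereal (norm z) \<le> ereal c" by (simp add: norm_blinfun_bound)
  qed
qed

definition thinned_set :: "'a::real_normed_vector set \<Rightarrow> real \<Rightarrow> 'a set" where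
  "thinned_set B t = {y\<in>B. \<exists>z :: 'a \<Rightarrow>\<^sub>L real.
     ereal (blinfun_apply z y) = set_gauge B y \<and> dual_set_norm B z \<le> 1 \<and> norm z \<le> t}"

text \<open>
  Nets are nonempty finite subsets of the whole space, not necessarily of \<open>A\<close>. Since they are
  nonempty, \<open>infdist x F\<close> is the distance \<open>d(x,F)\<close>.
\<close>

definition admissible_nets :: "nat \<Rightarrow> 'a set set" where
  "admissible_nets n = {F. finite F \<and> F \<noteq> {} \<and> card F < 2 ^ 2 ^ n}"

definition entropy_number :: "nat \<Rightarrow> 'a::metric_space set \<Rightarrow> ennreal" where
  "entropy_number n A = (INF F\<in>admissible_nets n. SUP x\<in>A. ennreal (infdist x F))"

definition gamma_functional :: "real \<Rightarrow> 'a::metric_space set \<Rightarrow> ennreal" where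
  "gamma_functional p A =
     (INF F\<in>{F. \<forall>n. F n \<in> admissible_nets n}.
        SUP x\<in>A. \<Sum>n. ennreal (2 powr (real n / p) * infdist x (F n)))"

text \<open>
  A constant depending on \<open>p\<close> only has to be uniform over all Banach spaces. An existential
  quantifier in a statement about a type \<open>'a\<close> would allow it to depend on \<open>'a\<close>; hence it is given
  explicitly. The value is the one obtained by summing
  \<open>(t\<^sub>n - t\<^sub>n\<^sub>-\<^sub>1) \<parallel>x - x\<^sub>n\<parallel> \<le> K(t\<^sub>n) - K(t\<^sub>n\<^sub>-\<^sub>1)\<close> for \<open>t\<^sub>n = a 2 powr (n / p)\<close>, where
  \<open>K(t) = inf\<^sub>y (\<parallel>y\<parallel>\<^sub>B + t \<parallel>x - y\<parallel>) \<le> 1\<close> for \<open>x \<in> B\<close> and \<open>x\<^sub>n\<close> attains \<open>K(t\<^sub>n)\<close>.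
\<close>

definition gamma_const :: "real \<Rightarrow> real" where
  "gamma_const p = 1 / (1 - 2 powr (- 1 / p))"

end

theory Submission
  imports Defs
begin

text \<open>
  Fix \<open>x \<in> B\<close> and let \<open>K(t) = inf\<^sub>y (\<parallel>y\<parallel>\<^sub>B + t \<parallel>x - y\<parallel>)\<close>, the interpolation functional between the
  gauge of \<open>B\<close> and the norm. Two facts about its minimizers carry the proof.

  The minimizers are thin. Compactness of \<open>B\<close> provides a minimizer \<open>y\<close>. As a function of
  \<open>x\<close>, \<open>K(t)\<close> is sublinear, so the Hahn--Banach theorem gives a linear functional \<open>z\<close> below it that
  agrees with it at \<open>x\<close>. Being below it forces \<open>\<parallel>z\<parallel>\<^sub>B\<^sup>* \<le> 1\<close> and \<open>\<parallel>z\<parallel>\<^sup>* \<le> t\<close>; agreeing with it at \<open>x\<close>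
  forces \<open>\<langle>z, y\<rangle> = \<parallel>y\<parallel>\<^sub>B\<close>. Hence \<open>y \<in> B\<^sub>t\<close> (lemma \<open>K_minimizer_thinned\<close>).

  The minimizers are close to \<open>x\<close>, on the average over scales. Using the minimizer \<open>y\<close> for the
  parameter \<open>t\<close> as a competitor for a smaller parameter \<open>u\<close> yields
  \<open>(t - u) \<parallel>x - y\<parallel> \<le> K(t) - K(u)\<close>. Along the geometric sequence \<open>t\<^sub>n = a 2\<^bsup>n/p\<^esup>\<close> the right-hand
  side telescopes and \<open>0 \<le> K \<le> 1\<close>, so that the weighted distances \<open>2\<^bsup>n/p\<^esup> \<parallel>x - y\<^sub>n\<parallel>\<close> sum to at
  most \<open>C / a\<close> (lemma \<open>weighted_distances_to_thinned_sets\<close>).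

  It remains to choose an almost optimal net of every \<open>B\<^bsub>t\<^sub>n\<^esub>\<close>: the distance of \<open>x\<close> to that net is at
  most \<open>\<parallel>x - y\<^sub>n\<parallel>\<close> plus almost the entropy number, uniformly in \<open>x\<close>.
\<close>

section \<open>Sublinear functionals and the Hahn--Banach theorem\<close>

definition sublinear :: "('a::real_vector \<Rightarrow> real) \<Rightarrow> bool" where
  "sublinear q \<longleftrightarrow> (\<forall>x y. q (x + y) \<le> q x + q y) \<and> (\<forall>c\<ge>0. \<forall>x. q (c *\<^sub>R x) = c * q x)"

lemma sublinear_add: "sublinear q \<Longrightarrow> q (x + y) \<le> q x + q y"
  by (simp add: sublinear_def)

lemma sublinear_scale: "sublinear q \<Longrightarrow> 0 \<le> c \<Longrightarrow> q (c *\<^sub>R x) = c * q x"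
  by (simp add: sublinear_def)

lemma sublinear_zero: "sublinear q \<Longrightarrow> q 0 = 0"
  using sublinear_scale[of q 0 0] by simp

lemma sublinear_neg_le: "sublinear q \<Longrightarrow> - q (- x) \<le> q x"
  using sublinear_add[of q x "- x"] sublinear_zero[of q] by simp

text \<open>
  Three infima below are sublinear for this same reason: sums and positive multiples of members of
  the family are dominated by members of the family. One inequality for each \<open>c > 0\<close> suffices for
  homogeneity, since the factor \<open>1 / c\<close> gives the reverse one; the factors \<open>2\<close> and \<open>1 / 2\<close> at the
  origin give the value \<open>0\<close> there.
\<close>

lemma sublinear_INF:
  fixes f :: "'i \<Rightarrow> 'a::real_vector \<Rightarrow> real"
  assumes ne: "I \<noteq> {}"
    and bdd: "\<And>x. bdd_below ((\<lambda>i. f i x) ` I)"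
    and add: "\<And>i j x y. i \<in> I \<Longrightarrow> j \<in> I \<Longrightarrow> \<exists>k\<in>I. f k (x + y) \<le> f i x + f j y"
    and scale: "\<And>i c x. i \<in> I \<Longrightarrow> 0 < c \<Longrightarrow> \<exists>k\<in>I. f k (c *\<^sub>R x) \<le> c * f i x"
  shows "sublinear (\<lambda>x. INF i\<in>I. f i x)"
proof -
  define q where "q = (\<lambda>x. INF i\<in>I. f i x)"
  have lower: "q x \<le> f i x" if "i \<in> I" for i x
    unfolding q_def using bdd that by (rule cINF_lower)
  have greatest: "m \<le> q x" if "\<And>i. i \<in> I \<Longrightarrow> m \<le> f i x" for m x
    unfolding q_def using ne that by (rule cINF_greatest)
  have "q (x + y) \<le> q x + q y" for x y
  proof -
    have "q (x + y) - f i x \<le> f j y" if ij: "i \<in> I" "j \<in> I" for i j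
      using add[OF ij, of x y] lower[of _ "x + y"] by fastforce
    then have "q (x + y) - f i x \<le> q y" if "i \<in> I" for i
      using that by (intro greatest)
    then have "q (x + y) - q y \<le> q x"
      by (intro greatest) (simp add: algebra_simps)
    then show ?thesis by simp
  qed
  moreover have le: "q (c *\<^sub>R x) \<le> c * q x" if "0 < c" for c x
  proof -
    have "q (c *\<^sub>R x) / c \<le> f i x" if "i \<in> I" for i
      using scale[OF that \<open>0 < c\<close>, of x] lower[of _ "c *\<^sub>R x"] \<open>0 < c\<close>
      by (fastforce simp: divide_le_eq mult.commute)
    then have "q (c *\<^sub>R x) / c \<le> q x" by (rule greatest)
    with \<open>0 < c\<close> show ?thesis by (simp add: divide_le_eq mult.commute)
  qed
  moreover have "q (c *\<^sub>R x) = c * q x" if "0 \<le> c" for c x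
  proof (cases "c = 0")
    case True
    have "q 0 = 0" using le[of 2 0] le[of "1 / 2" 0] by simp
    with True show ?thesis by simp
  next
    case False
    with that have "0 < c" by simp
    then have "c * q x \<le> q (c *\<^sub>R x)"
      using le[of "1 / c" "c *\<^sub>R x"] by (simp add: field_simps)
    with le[OF \<open>0 < c\<close>, of x] show ?thesis by simp
  qed
  ultimately show ?thesis
    unfolding q_def[symmetric] sublinear_def by blast
qed

text \<open>
  A sublinear functional can be lowered so that it becomes linear along the ray through \<open>v\<close>: the
  largest sublinear minorant of \<open>q\<close> with value at most \<open>- q v\<close> at \<open>- v\<close> is
  \<open>w \<mapsto> inf\<^bsub>r \<ge> 0\<^esub> (q (w + r v) - r q v)\<close>.
\<close>

lemma sublinear_minorant_along:
  fixes q :: "'a::real_vector \<Rightarrow> real"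
  assumes q: "sublinear q"
  shows "\<exists>q'. sublinear q' \<and> q' \<le> q \<and> (\<forall>w. q' w \<le> q (w + v) - q v)"
proof -
  define f where "f = (\<lambda>r w. q (w + r *\<^sub>R v) - r * q v)"
  have bdd: "bdd_below ((\<lambda>r. f r w) ` {0..})" for w
  proof (rule bdd_belowI2[of _ "- q (- w)"])
    fix r :: real assume "r \<in> {0..}"
    then have "r * q v = q (r *\<^sub>R v)" using q by (simp add: sublinear_scale)
    also have "\<dots> \<le> q (w + r *\<^sub>R v) + q (- w)"
      using sublinear_add[OF q, of "w + r *\<^sub>R v" "- w"] by simp
    finally show "- q (- w) \<le> f r w" by (simp add: f_def)
  qed
  have "sublinear (\<lambda>w. INF r\<in>{0..}. f r w)"
  proof (rule sublinear_INF[OF _ bdd])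
    fix r s :: real and x y :: 'a assume rs: "r \<in> {0..}" "s \<in> {0..}"
    have "f (r + s) (x + y) \<le> f r x + f s y"
      using sublinear_add[OF q, of "x + r *\<^sub>R v" "y + s *\<^sub>R v"]
      by (simp add: f_def algebra_simps)
    with rs show "\<exists>k\<in>{0..}. f k (x + y) \<le> f r x + f s y"
      by (intro bexI[of _ "r + s"]) auto
  next
    fix r c :: real and x :: 'a assume rc: "r \<in> {0..}" "0 < c"
    have "f (c * r) (c *\<^sub>R x) = c * f r x"
      using rc sublinear_scale[OF q, of c "x + r *\<^sub>R v"]
      by (simp add: f_def algebra_simps)
    with rc show "\<exists>k\<in>{0..}. f k (c *\<^sub>R x) \<le> c * f r x"
      by (intro bexI[of _ "c * r"]) auto
  qed simp
  moreover have "(INF r\<in>{0..}. f r w) \<le> f 0 w" "(INF r\<in>{0..}. f r w) \<le> f 1 w" for w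
    by (intro cINF_lower bdd; simp)+
  ultimately show ?thesis
    by (intro exI[of _ "\<lambda>w. INF r\<in>{0..}. f r w"]) (simp add: f_def le_fun_def)
qed

lemma sublinear_chain_lower_bound:
  fixes C :: "('a::real_vector \<Rightarrow> real) set"
  assumes ne: "C \<noteq> {}" and C: "\<And>q. q \<in> C \<Longrightarrow> sublinear q \<and> q \<le> p"
    and chain: "\<And>q r. q \<in> C \<Longrightarrow> r \<in> C \<Longrightarrow> q \<le> r \<or> r \<le> q"
  shows "\<exists>m. sublinear m \<and> (\<forall>q\<in>C. m \<le> q)"
proof -
  have bdd: "bdd_below ((\<lambda>q. q x) ` C)" for x
  proof (rule bdd_belowI2[of _ "- p (- x)"])
    fix q assume "q \<in> C"
    then show "- p (- x) \<le> q x"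
      using C[of q] sublinear_neg_le[of q x] by (force simp: le_fun_def dest: spec[of _ "- x"])
  qed
  have "sublinear (\<lambda>x. INF q\<in>C. q x)"
  proof (rule sublinear_INF[OF ne bdd])
    fix q r x y assume qr: "q \<in> C" "r \<in> C"
    from chain[OF qr] show "\<exists>k\<in>C. k (x + y) \<le> q x + r y"
    proof
      assume "q \<le> r"
      then have "q (x + y) \<le> q x + r y"
        using C[OF qr(1)] sublinear_add[of q x y] le_funD[of q r y] by simp
      with qr show ?thesis by blast
    next
      assume "r \<le> q"
      then have "r (x + y) \<le> q x + r y"
        using C[OF qr(2)] sublinear_add[of r x y] le_funD[of r q x] by simp
      with qr show ?thesis by blast
    qed
  next
    fix q :: "'a \<Rightarrow> real" and c :: real and x assume "q \<in> C" "0 < c"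
    then show "\<exists>k\<in>C. k (c *\<^sub>R x) \<le> c * q x"
      using C[of q] sublinear_scale[of q c x] by (intro bexI[of _ q]) auto
  qed
  then show ?thesis
    by (intro exI[of _ "\<lambda>x. INF q\<in>C. q x"])
      (auto simp: le_fun_def intro!: cINF_lower bdd)
qed

text \<open>
  A minimal sublinear functional coincides with each of its minorants from
  \<open>sublinear_minorant_along\<close>, which makes it superadditive as well, hence linear.
\<close>

theorem Hahn_Banach_linear_minorant:
  fixes p :: "'a::real_vector \<Rightarrow> real"
  assumes p: "sublinear p"
  obtains z where "linear z" "z \<le> p"
proof -
  define A where "A = {q. sublinear q \<and> q \<le> p}"
  have po: "partial_order_on A (relation_of (\<ge>) A)"
    by (rule partial_order_on_relation_ofI) auto
  have "\<exists>m\<in>A. \<forall>q\<in>A. m \<ge> q \<longrightarrow> q = m"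
  proof (rule predicate_Zorn[OF po])
    fix C assume C: "C \<in> Chains (relation_of (\<ge>) A)"
    show "\<exists>u\<in>A. \<forall>q\<in>C. q \<ge> u"
    proof (cases "C = {}")
      case True
      with p show ?thesis by (auto simp: A_def)
    next
      case False
      have mem: "sublinear q \<and> q \<le> p" if "q \<in> C" for q
        using C that by (auto simp: Chains_def relation_of_def A_def)
      have "q \<le> r \<or> r \<le> q" if "q \<in> C" "r \<in> C" for q r
        using C that by (auto simp: Chains_def relation_of_def)
      with False mem obtain m where "sublinear m" "\<forall>q\<in>C. m \<le> q"
        using sublinear_chain_lower_bound[of C p] by blast
      moreover from this False mem have "m \<le> p" by (metis ex_in_conv order_trans)
      ultimately show ?thesis by (auto simp: A_def)
    qed
  qed
  then obtain z where z: "sublinear z" "z \<le> p"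
    and min: "\<And>q. sublinear q \<Longrightarrow> q \<le> z \<Longrightarrow> q = z"
    by (auto simp: A_def dest: order_trans)
  have add: "z (x + y) = z x + z y" for x y
  proof -
    obtain q where "sublinear q" "q \<le> z" and q: "\<And>w. q w \<le> z (w + y) - z y"
      using sublinear_minorant_along[OF z(1), of y] by blast
    with min have "z x \<le> z (x + y) - z y" by metis
    with sublinear_add[OF z(1), of x y] show ?thesis by simp
  qed
  have neg: "z (- x) = - z x" for x
    using add[of x "- x"] sublinear_zero[OF z(1)] by simp
  have "z (c *\<^sub>R x) = c * z x" for c x
  proof (cases "0 \<le> c")
    case False
    then show ?thesis
      using sublinear_scale[OF z(1), of "- c" x] neg[of "c *\<^sub>R x"] by simp
  qed (simp add: sublinear_scale[OF z(1)])
  with add have "linear z" by (intro linearI) auto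
  with z(2) that show thesis by blast
qed

text \<open>
  Lowering \<open>p\<close> along \<open>v\<close> first pins every linear minorant: its value at \<open>- v\<close> is at most
  \<open>- p v\<close>, hence its value at \<open>v\<close> at least \<open>p v\<close>.
\<close>

corollary Hahn_Banach_supporting_functional:
  fixes p :: "'a::real_vector \<Rightarrow> real"
  assumes p: "sublinear p"
  obtains z where "linear z" "z \<le> p" "z v = p v"
proof -
  obtain q where q: "sublinear q" "q \<le> p" "\<And>w. q w \<le> p (w + v) - p v"
    using sublinear_minorant_along[OF p, of v] by blast
  obtain z where z: "linear z" "z \<le> q"
    using Hahn_Banach_linear_minorant[OF q(1)] by blast
  have "z (- v) \<le> p (- v + v) - p v"
    using le_funD[OF z(2)] q(3) by (rule order_trans)
  then have "p v \<le> z v"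
    by (simp add: linear_neg[OF z(1)] sublinear_zero[OF p])
  moreover have "z \<le> p" using z(2) q(2) by (rule order_trans)
  ultimately show thesis
    using that[OF z(1)] by (simp add: le_fun_def order_antisym)
qed

section \<open>The interpolation functional between the gauge and the norm\<close>

text \<open>
  Writing the competitor as \<open>y = s b\<close> with \<open>b \<in> B\<close> replaces the gauge, which is only lower
  semicontinuous and may be infinite, by the real variable \<open>s\<close>: the objective becomes finite and
  continuous.
\<close>

definition K_functional :: "'a::real_normed_vector set \<Rightarrow> real \<Rightarrow> 'a \<Rightarrow> real" where
  "K_functional B t x = (INF (s, b)\<in>{0..} \<times> B. s + t * norm (x - s *\<^sub>R b))"

lemma K_functional_le:
  assumes "0 \<le> t" "0 \<le> s" "b \<in> B"
  shows "K_functional B t x \<le> s + t * norm (x - s *\<^sub>R b)"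
proof -
  have "bdd_below ((\<lambda>(s, b). s + t * norm (x - s *\<^sub>R b)) ` ({0..} \<times> B))"
    using assms(1) by (intro bdd_belowI2[of _ 0]) auto
  from cINF_lower[OF this, of "(s, b)"] assms show ?thesis
    by (simp add: K_functional_def)
qed

lemma K_functional_greatest:
  assumes "B \<noteq> {}" "\<And>s b. 0 \<le> s \<Longrightarrow> b \<in> B \<Longrightarrow> m \<le> s + t * norm (x - s *\<^sub>R b)"
  shows "m \<le> K_functional B t x"
  unfolding K_functional_def using assms by (intro cINF_greatest) auto

lemma K_functional_nonneg: "B \<noteq> {} \<Longrightarrow> 0 \<le> t \<Longrightarrow> 0 \<le> K_functional B t x"
  by (rule K_functional_greatest) auto

lemma K_functional_le_one: "x \<in> B \<Longrightarrow> 0 \<le> t \<Longrightarrow> K_functional B t x \<le> 1"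
  using K_functional_le[of t 1 x B x] by simp

lemma K_functional_le_norm: "B \<noteq> {} \<Longrightarrow> 0 \<le> t \<Longrightarrow> K_functional B t x \<le> t * norm x"
  using K_functional_le[of t 0 _ B x] by auto

lemma sublinear_K_functional:
  fixes B :: "'a::real_normed_vector set"
  assumes B: "convex B" "B \<noteq> {}" and t: "0 \<le> t"
  shows "sublinear (K_functional B t)"
proof -
  define f where "f = (\<lambda>(s :: real, b :: 'a) x. s + t * norm (x - s *\<^sub>R b))"
  have "sublinear (\<lambda>x. INF i\<in>{0..} \<times> B. f i x)"
  proof (rule sublinear_INF)
    show "bdd_below ((\<lambda>i. f i x) ` ({0..} \<times> B))" for x
      using t by (intro bdd_belowI2[of _ 0]) (auto simp: f_def)
  next
    fix i j :: "real \<times> 'a" and x y assume ij: "i \<in> {0..} \<times> B" "j \<in> {0..} \<times> B"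
    obtain s b s' b' where sb: "i = (s, b)" "j = (s', b')" by fastforce
    with ij have pos: "0 \<le> s" "0 \<le> s'" and mem: "b \<in> B" "b' \<in> B" by auto
    have "\<exists>w\<in>B. (s + s') *\<^sub>R w = s *\<^sub>R b + s' *\<^sub>R b'"
    proof (cases "s + s' = 0")
      case True
      with pos mem show ?thesis by (auto simp: add_nonneg_eq_0_iff)
    next
      case False
      define w where "w = (s / (s + s')) *\<^sub>R b + (s' / (s + s')) *\<^sub>R b'"
      have "w \<in> B"
        unfolding w_def using B(1) mem pos False
        by (intro convexD) (auto simp: add_divide_distrib[symmetric])
      with False show ?thesis
        by (intro bexI[of _ w]) (auto simp: w_def scaleR_add_right)
    qed
    then obtain w where w: "w \<in> B" "(s + s') *\<^sub>R w = s *\<^sub>R b + s' *\<^sub>R b'" by blast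
    have "norm (x + y - (s + s') *\<^sub>R w) \<le> norm (x - s *\<^sub>R b) + norm (y - s' *\<^sub>R b')"
      unfolding w(2) using norm_triangle_ineq[of "x - s *\<^sub>R b" "y - s' *\<^sub>R b'"]
      by (simp add: algebra_simps)
    from mult_left_mono[OF this t] have "f (s + s', w) (x + y) \<le> f i x + f j y"
      by (simp add: f_def sb algebra_simps)
    with w(1) pos show "\<exists>k\<in>{0..} \<times> B. f k (x + y) \<le> f i x + f j y"
      by (intro bexI[of _ "(s + s', w)"]) auto
  next
    fix i :: "real \<times> 'a" and c :: real and x assume i: "i \<in> {0..} \<times> B" and c: "0 < c"
    obtain s b where sb: "i = (s, b)" by fastforce
    have "norm (c *\<^sub>R x - (c * s) *\<^sub>R b) = c * norm (x - s *\<^sub>R b)"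
      using c by (simp flip: scaleR_scaleR scaleR_diff_right)
    then have "f (c * s, b) (c *\<^sub>R x) = c * f i x"
      by (simp add: f_def sb algebra_simps)
    with i c sb show "\<exists>k\<in>{0..} \<times> B. f k (c *\<^sub>R x) \<le> c * f i x"
      by (intro bexI[of _ "(c * s, b)"]) auto
  qed (use B in auto)
  moreover have "(\<lambda>x. INF i\<in>{0..} \<times> B. f i x) = K_functional B t"
    by (intro ext) (simp add: K_functional_def f_def case_prod_unfold)
  ultimately show ?thesis by simp
qed

text \<open>
  Since \<open>K \<le> 1\<close> on \<open>B\<close>, only \<open>s \<le> 1\<close> matters, and the infimum runs over a compact set.
\<close>

lemma K_functional_attained:
  fixes B :: "'a::real_normed_vector set"
  assumes "compact B" "x \<in> B" "0 \<le> t"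
  obtains s :: real and b where "0 \<le> s" "s \<le> 1" "b \<in> B"
    "K_functional B t x = s + t * norm (x - s *\<^sub>R b)"
proof -
  define f where "f = (\<lambda>(s::real, b). s + t * norm (x - s *\<^sub>R b))"
  have "compact ({0..1::real} \<times> B)" "{0..1::real} \<times> B \<noteq> {}"
    using assms by (auto intro: compact_Times)
  moreover have "continuous_on ({0..1} \<times> B) f"
    unfolding f_def case_prod_unfold by (intro continuous_intros)
  ultimately obtain i where i: "i \<in> {0..1} \<times> B" "\<And>j. j \<in> {0..1} \<times> B \<Longrightarrow> f i \<le> f j"
    using continuous_attains_inf by metis
  obtain s b where sb: "i = (s, b)" by fastforce
  have "f i \<le> K_functional B t x"
  proof (rule K_functional_greatest)
    fix s' b' assume s': "(0::real) \<le> s'" "b' \<in> B"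
    show "f i \<le> s' + t * norm (x - s' *\<^sub>R b')"
    proof (cases "s' \<le> 1")
      case True
      with s' i(2)[of "(s', b')"] show ?thesis by (simp add: f_def)
    next
      case False
      have "f i \<le> f (1, x)" using assms by (intro i(2)) auto
      also have "\<dots> = 1" by (simp add: f_def)
      also have "\<dots> \<le> s' + t * norm (x - s' *\<^sub>R b')"
        using False assms(3) by (intro add_increasing2) auto
      finally show ?thesis .
    qed
  qed (use assms in auto)
  moreover have "K_functional B t x \<le> f i"
    using i(1) assms(3) K_functional_le[of t s b B x] by (simp add: sb f_def)
  ultimately show thesis
    using that[of s b] i(1) by (auto simp: sb f_def)
qed

text \<open>
  For the minimizer \<open>y = s b\<close> minimality gives \<open>\<parallel>y\<parallel>\<^sub>B = s\<close>. A functional \<open>z\<close> supporting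
  \<open>K\<close> at \<open>x\<close> satisfies \<open>\<langle>z, y\<rangle> \<le> s\<close> and \<open>\<langle>z, x - y\<rangle> \<le> t \<parallel>x - y\<parallel>\<close>, while the two right-hand sides
  add up to \<open>K = \<langle>z, x\<rangle>\<close>; so both are equalities, and \<open>z\<close> certifies \<open>y \<in> B\<^sub>t\<close>. The displayed
  inequality is what remains of minimality once \<open>y\<close> competes at another parameter \<open>u\<close>.
\<close>

lemma K_minimizer_thinned:
  fixes B :: "'a::real_normed_vector set"
  assumes B: "compact B" "convex B" "0 \<in> B" and x: "x \<in> B" and t: "0 < t"
  obtains y where "y \<in> thinned_set B t"
    "\<And>u. 0 \<le> u \<Longrightarrow> (t - u) * norm (x - y) \<le> K_functional B t x - K_functional B u x"
proof -
  obtain s b where s: "0 \<le> s" "s \<le> 1" and b: "b \<in> B"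
    and K: "K_functional B t x = s + t * norm (x - s *\<^sub>R b)"
    using K_functional_attained[of B x t] B x t by auto
  define y where "y = s *\<^sub>R b"
  have "convex B" "B \<noteq> {}" "0 \<le> t" using B t by auto
  then obtain z where z: "linear z" "z \<le> K_functional B t" "z x = K_functional B t x"
    using Hahn_Banach_supporting_functional[OF sublinear_K_functional[of B t]] by blast
  have z_norm: "z w \<le> t * norm w" for w
    using le_funD[OF z(2), of w] K_functional_le_norm[OF \<open>B \<noteq> {}\<close> \<open>0 \<le> t\<close>, of w] by simp
  have z_one: "z w \<le> 1" if "w \<in> B" for w
    using le_funD[OF z(2), of w] K_functional_le_one[OF that \<open>0 \<le> t\<close>] by simp
  have z_abs: "norm (z w) \<le> t * norm w" for w
    using z_norm[of w] z_norm[of "- w"] by (simp add: linear_neg[OF z(1)] abs_le_iff)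
  have "bounded_linear z"
    using z(1) z_abs by (intro bounded_linear_intro[of _ t])
      (auto simp: linear_add linear_scale mult.commute)
  then have z_apply: "blinfun_apply (Blinfun z) = z"
    by (rule bounded_linear_Blinfun_apply)
  have "z y \<le> s"
    using mult_left_mono[OF z_one[OF b] s(1)] by (simp add: y_def linear_scale[OF z(1)])
  moreover have "z x = z y + z (x - y)"
    by (simp add: linear_diff[OF z(1)])
  ultimately have "z y = s"
    using z_norm[of "x - y"] z(3) K by (simp add: y_def)
  moreover have "set_gauge B y = ereal s"
  proof (rule antisym)
    show "set_gauge B y \<le> ereal s"
      unfolding set_gauge_def using s b by (intro INF_lower) (auto simp: y_def)
    have "s \<le> r" if "0 \<le> r" "c \<in> B" "y = r *\<^sub>R c" for r c
      using K_functional_le[OF \<open>0 \<le> t\<close> that(1,2), of x] K that(3) by (simp add: y_def)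
    then show "ereal s \<le> set_gauge B y"
      unfolding set_gauge_def by (intro INF_greatest) auto
  qed
  moreover have "dual_set_norm B (Blinfun z) \<le> 1"
    unfolding dual_set_norm_def by (intro SUP_least) (simp add: z_apply z_one)
  moreover have "norm (Blinfun z) \<le> t"
    using z_abs \<open>0 \<le> t\<close> by (intro norm_blinfun_bound) (auto simp: z_apply)
  moreover have "y \<in> B"
    using convexD[OF B(2) b B(3), of s "1 - s"] s by (simp add: y_def)
  ultimately have "y \<in> thinned_set B t"
    by (auto simp: thinned_set_def z_apply intro!: exI[of _ "Blinfun z"])
  moreover have "(t - u) * norm (x - y) \<le> K_functional B t x - K_functional B u x" if "0 \<le> u" for u
    using K_functional_le[OF that s(1) b, of x] K by (simp add: y_def algebra_simps)
  ultimately show thesis using that by blast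
qed

section \<open>Summation over the scales\<close>

lemma gamma_const_ge_one:
  assumes "0 < p"
  shows "1 \<le> gamma_const p"
proof -
  have "2 powr (- 1 / p) < (2::real) powr 0"
    using assms by (intro powr_less_mono) auto
  moreover have "(0::real) < 2 powr (- 1 / p)" by simp
  ultimately show ?thesis by (simp add: gamma_const_def)
qed

lemma weighted_distances_to_thinned_sets:
  fixes B :: "'a::real_normed_vector set"
  assumes B: "compact B" "convex B" "0 \<in> B" and x: "x \<in> B" and p: "0 < p" and a: "0 < a"
  obtains y where "\<And>n. y n \<in> thinned_set B (a * 2 powr (real n / p))"
    "(\<Sum>n. ennreal (2 powr (real n / p) * norm (x - y n))) \<le> ennreal (gamma_const p / a)"
proof -
  \<comment> \<open>The shift by one gives room for the scale \<open>t\<^sub>-\<^sub>1\<close> from which the telescoping sum starts.\<close>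
  define t where "t = (\<lambda>n. a * 2 powr ((real n - 1) / p))"
  have t: "0 < t n" for n using a by (simp add: t_def)
  define k where "k = (\<lambda>n. K_functional B (t n) x)"
  have "\<exists>y. y \<in> thinned_set B (t (Suc n)) \<and>
      (t (Suc n) - t n) * norm (x - y) \<le> k (Suc n) - k n" for n
    using K_minimizer_thinned[OF B x t[of "Suc n"]] t[of n] unfolding k_def
    by (metis less_imp_le)
  then obtain y where y: "\<And>n. y n \<in> thinned_set B (t (Suc n))"
    and dist: "\<And>n. (t (Suc n) - t n) * norm (x - y n) \<le> k (Suc n) - k n"
    by metis
  have c: "0 < gamma_const p" using gamma_const_ge_one[OF p] by simp
  have diff: "t (Suc n) - t n = a / gamma_const p * 2 powr (real n / p)" for n
  proof -
    have "2 powr ((real n - 1) / p) = 2 powr (real n / p) * 2 powr (- 1 / p)"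
      by (simp add: diff_divide_distrib flip: powr_add)
    then show ?thesis by (simp add: t_def gamma_const_def algebra_simps)
  qed
  have "(\<Sum>n<N. 2 powr (real n / p) * norm (x - y n)) \<le> gamma_const p / a" for N
  proof -
    have "a / gamma_const p * (\<Sum>n<N. 2 powr (real n / p) * norm (x - y n))
        = (\<Sum>n<N. (t (Suc n) - t n) * norm (x - y n))"
      by (simp add: diff sum_distrib_left mult.assoc)
    also have "\<dots> \<le> (\<Sum>n<N. k (Suc n) - k n)" by (intro sum_mono dist)
    also have "\<dots> = k N - k 0" by (rule sum_lessThan_telescope)
    also have "\<dots> \<le> 1"
      using K_functional_le_one[OF x, of "t N"] K_functional_nonneg[of B "t 0" x] x t
      unfolding k_def by (smt (verit) empty_iff)
    finally show ?thesis using a c by (simp add: field_simps)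
  qed
  then have "(\<Sum>n. ennreal (2 powr (real n / p) * norm (x - y n))) \<le> ennreal (gamma_const p / a)"
    by (intro suminf_le_const) (simp_all add: sum_ennreal ennreal_leI)
  moreover have "t (Suc n) = a * 2 powr (real n / p)" for n by (simp add: t_def)
  ultimately show thesis using that[of y] y by simp
qed

lemma admissible_net_near_entropy_number:
  fixes A :: "'a::metric_space set"
  assumes "0 < d"
  shows "\<exists>F\<in>admissible_nets n. \<forall>x\<in>A. ennreal (infdist x F) \<le> entropy_number n A + ennreal d"
proof (cases "entropy_number n A = top")
  case True
  have "(2::nat) ^ 0 < 2 ^ 2 ^ n" by (rule power_strict_increasing) auto
  \<comment> \<open>Any net will do; the bound \<open>card F < 2 ^ 2 ^ n\<close> leaves room for one point even at \<open>n = 0\<close>.\<close>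
  then have "{undefined} \<in> admissible_nets n" by (simp add: admissible_nets_def)
  with True show ?thesis by auto
next
  case False
  then have "entropy_number n A < entropy_number n A + ennreal d"
    using assms by (simp add: ennreal_add_left_cancel_less)
  then obtain F where "F \<in> admissible_nets n"
    "(SUP x\<in>A. ennreal (infdist x F)) < entropy_number n A + ennreal d"
    unfolding entropy_number_def by (subst (asm) INF_less_iff) blast
  then show ?thesis by (meson SUP_lessD less_imp_le)
qed

theorem corollary2p7:
  fixes B :: "'a::banach set" and p a :: real
  assumes "\<forall>x\<in>B. - x \<in> B" and "compact B" and "convex B"
    and "p > 0" and "a > 0"
  shows "gamma_functional p B \<le> ennreal (gamma_const p) *
    (ennreal (1 / a) +
     (\<Sum>n. ennreal (2 powr (real n / p)) *
        entropy_number n (thinned_set B (a * 2 powr (real n / p)))))"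
proof -
  define w where "w = (\<lambda>n::nat. 2 powr (real n / p))"
  define T where "T = (\<lambda>n. thinned_set B (a * w n))"
  define S where "S = (\<Sum>n. ennreal (w n) * entropy_number n (T n))"
  have w: "0 < w n" for n by (simp add: w_def)
  have "gamma_functional p B \<le> ennreal (gamma_const p / a) + S"
  proof (rule ennreal_le_epsilon)
    fix e :: real assume e: "0 < e"
    \<comment> \<open>The tolerances are chosen such that their weighted sum is \<open>e\<close>.\<close>
    define d where "d = (\<lambda>n. e * (1 / 2) ^ Suc n / w n)"
    have d: "0 < d n" for n using e w by (simp add: d_def)
    have "\<exists>F. \<forall>n. F n \<in> admissible_nets n \<and>
        (\<forall>x\<in>T n. ennreal (infdist x (F n)) \<le> entropy_number n (T n) + ennreal (d n))"
      using admissible_net_near_entropy_number[OF d] by (intro choice) blast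
    then obtain F where F: "\<And>n. F n \<in> admissible_nets n"
      and near: "\<And>n x. x \<in> T n \<Longrightarrow> ennreal (infdist x (F n)) \<le> entropy_number n (T n) + ennreal (d n)"
      by blast
    have "(\<lambda>n. e * (1 / 2) ^ Suc n) sums e"
      using sums_mult[OF power_half_series, of e] by simp
    then have "(\<Sum>n. ennreal (e * (1 / 2) ^ Suc n)) = ennreal e"
      using e by (intro suminf_ennreal_eq) auto
    moreover have "ennreal (w n) * ennreal (d n) = ennreal (e * (1 / 2) ^ Suc n)" for n
      using w[of n] d[of n] by (simp add: d_def flip: ennreal_mult)
    ultimately have sum_d: "(\<Sum>n. ennreal (w n) * ennreal (d n)) = ennreal e"
      by simp
    have "(\<Sum>n. ennreal (w n * infdist x (F n))) \<le> ennreal (gamma_const p / a) + S + ennreal e"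
      if x: "x \<in> B" for x
    proof -
      have "0 \<in> B"
        using convexD[OF assms(3) x, of "- x" "1 / 2" "1 / 2"] assms(1) x by simp
      then obtain y where y: "\<And>n. y n \<in> T n"
        and sum_y: "(\<Sum>n. ennreal (w n * norm (x - y n))) \<le> ennreal (gamma_const p / a)"
        using weighted_distances_to_thinned_sets[OF assms(2,3) _ x assms(4,5)]
        unfolding T_def w_def by metis
      have "ennreal (w n * infdist x (F n)) \<le> ennreal (w n * norm (x - y n)) +
          ennreal (w n) * entropy_number n (T n) + ennreal (w n) * ennreal (d n)" for n
      proof -
        have "ennreal (infdist x (F n)) \<le> ennreal (norm (x - y n)) + ennreal (infdist (y n) (F n))"
          using infdist_triangle[of x "F n" "y n"]
          by (simp add: dist_norm infdist_nonneg ennreal_leI add.commute flip: ennreal_plus)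
        also have "\<dots> \<le> ennreal (norm (x - y n)) + (entropy_number n (T n) + ennreal (d n))"
          by (intro add_left_mono near y)
        finally have "ennreal (w n) * ennreal (infdist x (F n)) \<le>
            ennreal (w n) * (ennreal (norm (x - y n)) + (entropy_number n (T n) + ennreal (d n)))"
          by (rule mult_left_mono) simp
        then show ?thesis
          using w[of n] by (simp add: ennreal_mult infdist_nonneg distrib_left add.assoc)
      qed
      then have "(\<Sum>n. ennreal (w n * infdist x (F n))) \<le> (\<Sum>n. ennreal (w n * norm (x - y n)) +
          ennreal (w n) * entropy_number n (T n) + ennreal (w n) * ennreal (d n))"
        by (intro suminf_le) auto
      also have "\<dots> = (\<Sum>n. ennreal (w n * norm (x - y n))) + S + ennreal e"
        by (simp add: suminf_add[symmetric] S_def sum_d)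
      also have "\<dots> \<le> ennreal (gamma_const p / a) + S + ennreal e"
        by (intro add_right_mono sum_y)
      finally show ?thesis .
    qed
    then have "(SUP x\<in>B. \<Sum>n. ennreal (w n * infdist x (F n)))
        \<le> ennreal (gamma_const p / a) + S + ennreal e"
      by (rule SUP_least)
    with F show "gamma_functional p B \<le> ennreal (gamma_const p / a) + S + ennreal e"
      unfolding gamma_functional_def w_def by (intro INF_lower2[of F]) auto
  qed
  also have "\<dots> \<le> ennreal (gamma_const p) * (ennreal (1 / a) + S)"
  proof -
    have c: "1 \<le> gamma_const p" using assms(4) by (rule gamma_const_ge_one)
    have "S \<le> ennreal (gamma_const p) * S"
      using mult_right_mono[OF ennreal_leI[OF c], of S] by simp
    moreover have "ennreal (gamma_const p / a) = ennreal (gamma_const p) * ennreal (1 / a)"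
      using c assms(5) by (simp flip: ennreal_mult)
    ultimately show ?thesis by (simp add: distrib_left add_left_mono)
  qed
  finally show ?thesis by (simp add: S_def T_def w_def)
qed

end
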